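(* Let $d\ge1$ and let $r$ be a positive integer with $r>d/2$. (1) (Sobolev case, $\rho=0$) There exists a constant $C_{r,d}>0$ such that for all $u_1,u_2\in H^r(\mathbb{T}^d,\mathbb{R})$ the product $u_1\cdot u_2$ belongs to $H^r(\mathbb{T}^d,\mathbb{R})$ and $$\|u_1\cdot u_2\|_r\le C_{r,d}\|u_1\|_r\|u_2\|_r.$$ (2) (Analytic case) Let $\rho>0$. There exists a constant $C_{\rho,r,d}>0$ such that for all $u_1,u_2\in H^{\rho,r}(\mathbb{T}^d_\rho,\mathbb{C})$ the product $u_1\cdot u_2$ belongs to $H^{\rho,r}(\mathbb{T}^d_\rho,\mathbb{C})$ and $$\|u_1\cdot u_2\|_{\rho,r}\le C_{\rho,r,d}\|u_1\|_{\rho,r}\|u_2\|_{\rho,r}.$$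
   Context: For $\rho\ge0$, $\mathbb{T}^d_\rho=\{x\in\mathbb{C}^d/(2\pi\mathbb{Z})^d:|\mathrm{Im}\,x_j|\le\rho,\ j=1,\dots,d\}$ and $\mathbb{T}^d=\mathbb{T}^d_0$. For $k\in\mathbb{Z}^d$, $|k|=\sum_{i}|k_i|$. $H^{\rho,r}(\mathbb{T}^d_\rho,\mathbb{C})$ is the Hilbert space of functions $u:\mathbb{T}^d_\rho\to\mathbb{C}$, $u(x)=\sum_{k\in\mathbb{Z}^d}\hat u_ke^{\mathrm{i}k\cdot x}$, with $\|u\|_{\rho,r}^2=\sum_{k\in\mathbb{Z}^d}|\hat u_k|^2e^{2|k|\rho}(1+|k|^2)^r<\infty$. $H^r=H^{0,r}$ with norm $\|\cdot\|_r=\|\cdot\|_{0,r}$ is the standard Sobolev space on $\mathbb{T}^d$. *)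

theory Defs
  imports "HOL-Analysis.Analysis"
begin

text \<open>
  The dimension is \<open>CARD('d)\<close>. A function on \<open>\<complex>\<^sup>d/(2\<pi>\<int>)\<^sup>d\<close> is a periodic function on the
  covering space; only its values on the strip are ever used.
\<close>

definition strip :: "real \<Rightarrow> (complex ^ 'd) set" where
  "strip \<rho> = {x. \<forall>j. \<bar>Im (x $ j)\<bar> \<le> \<rho>}"

definition periodic_on_strip :: "real \<Rightarrow> (complex ^ 'd \<Rightarrow> complex) \<Rightarrow> bool" where
  "periodic_on_strip \<rho> u \<longleftrightarrow>
     (\<forall>x\<in>strip \<rho>. \<forall>m :: int ^ 'd. u (\<chi> j. x $ j + 2 * of_real pi * of_int (m $ j)) = u x)"

definition abs1 :: "int ^ 'd \<Rightarrow> real" where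
  "abs1 k = (\<Sum>j\<in>UNIV. of_int \<bar>k $ j\<bar>)"

definition fourier_mode :: "int ^ 'd \<Rightarrow> complex ^ 'd \<Rightarrow> complex" where
  "fourier_mode k x = exp (\<i> * (\<Sum>j\<in>UNIV. of_int (k $ j) * x $ j))"

definition real_point :: "real ^ 'd \<Rightarrow> complex ^ 'd" where
  "real_point x = (\<chi> j. of_real (x $ j))"

definition period_cell :: "(real ^ 'd) set" where
  "period_cell = cbox 0 (\<chi> j. 2 * pi)"

definition fourier_coeff :: "(complex ^ 'd \<Rightarrow> complex) \<Rightarrow> int ^ 'd \<Rightarrow> complex" where
  "fourier_coeff u k =
     (LINT x:period_cell|lebesgue. u (real_point x) * fourier_mode (- k) (real_point x))
       / of_real ((2 * pi) ^ CARD('d))"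

definition L2_fourier_expansion :: "(complex ^ 'd \<Rightarrow> complex) \<Rightarrow> bool" where
  "L2_fourier_expansion u \<longleftrightarrow>
     set_borel_measurable lebesgue period_cell (\<lambda>x. u (real_point x)) \<and>
     set_integrable lebesgue period_cell (\<lambda>x. (cmod (u (real_point x)))\<^sup>2) \<and>
     ((\<lambda>K. LINT x:period_cell|lebesgue.
         (cmod (u (real_point x) - (\<Sum>k\<in>K. fourier_coeff u k * fourier_mode k (real_point x))))\<^sup>2)
       \<longlongrightarrow> 0) (finite_subsets_at_top UNIV)"

definition pointwise_fourier_expansion :: "real \<Rightarrow> (complex ^ 'd \<Rightarrow> complex) \<Rightarrow> bool" where
  "pointwise_fourier_expansion \<rho> u \<longleftrightarrow>
     (\<forall>x\<in>strip \<rho>. ((\<lambda>k. fourier_coeff u k * fourier_mode k x) has_sum u x) UNIV)"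

definition H_weight :: "real \<Rightarrow> nat \<Rightarrow> int ^ 'd \<Rightarrow> real" where
  "H_weight \<rho> r k = exp (2 * abs1 k * \<rho>) * (1 + (abs1 k)\<^sup>2) ^ r"

text \<open>
  For \<open>\<rho> = 0\<close> the expansion of \<open>u\<close> in its Fourier series is the \<open>L\<^sup>2\<close> identity of
  the standard Sobolev space, whose elements are represented here by functions rather than by
  classes modulo null sets. For \<open>\<rho> > 0\<close> it is required at every point of the closed strip; the
  definition is meant for \<open>r > d/2\<close>, where a finite norm makes the series absolutely convergent
  there, boundary included.
\<close>

definition H_space :: "real \<Rightarrow> nat \<Rightarrow> (complex ^ 'd \<Rightarrow> complex) set" where
  "H_space \<rho> r =
     {u. periodic_on_strip \<rho> u \<and>
         (if \<rho> = 0 then L2_fourier_expansion u else pointwise_fourier_expansion \<rho> u) \<and>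
         (\<lambda>k. (cmod (fourier_coeff u k))\<^sup>2 * H_weight \<rho> r k) summable_on UNIV}"

definition H_norm :: "real \<Rightarrow> nat \<Rightarrow> (complex ^ 'd \<Rightarrow> complex) \<Rightarrow> real" where
  "H_norm \<rho> r u = sqrt (\<Sum>\<^sub>\<infinity>k. (cmod (fourier_coeff u k))\<^sup>2 * H_weight \<rho> r k)"

definition H_space_real :: "nat \<Rightarrow> (complex ^ 'd \<Rightarrow> complex) set" where
  "H_space_real r = {u \<in> H_space 0 r. \<forall>x\<in>strip 0. u x \<in> \<real>}"

end

theory Submission
  imports Defs
begin

text \<open>
  Let \<open>w = H_weight \<rho> r\<close>. Since \<open>|l + m| \<le> |l| + |m|\<close>, the ratio \<open>w (l + m) / (w l * w m)\<close> is at most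
  \<open>4\<^sup>r ((1 + |l|\<^sup>2)\<^sup>-\<^sup>r + (1 + |m|\<^sup>2)\<^sup>-\<^sup>r)\<close>, whatever \<open>\<rho> \<ge> 0\<close> is, and for \<open>r > d/2\<close> this is summable
  over \<open>l + m = k\<close> uniformly in \<open>k\<close>. By Cauchy--Schwarz, \<open>|(a * b)\<^sub>k|\<^sup>2 w k\<close> is then bounded by a constant times
  the convolution of \<open>|a|\<^sup>2 w\<close> and \<open>|b|\<^sup>2 w\<close> at \<open>k\<close>, and summing over \<open>k\<close> gives the norm estimate for
  the convolution of the coefficient sequences. Also for \<open>r > d/2\<close>, coefficients of functions in the
  space are absolutely summable (with the factor \<open>exp (|k| \<rho>)\<close>), so \<open>u\<close> equals its Fourier series almost
  everywhere on the period cell (everywhere on the strip if \<open>\<rho> > 0\<close>); multiplying the series identifies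
  the Fourier coefficients of the product with the convolution.
\<close>

section \<open>Sums over the lattice\<close>

text \<open>The finite inequality bounds all partial sums by one number, so the bound passes to the
  infinite sum. Absolute values stay inside the sum because the later applications estimate norms
  term by term.\<close>

lemma infsum_Cauchy_Schwarz:
  fixes f g :: "'a \<Rightarrow> real"
  assumes f: "(\<lambda>x. (f x)\<^sup>2) summable_on A" and g: "(\<lambda>x. (g x)\<^sup>2) summable_on A"
  shows "(\<lambda>x. \<bar>f x * g x\<bar>) summable_on A"
    and "(\<Sum>\<^sub>\<infinity>x\<in>A. \<bar>f x * g x\<bar>)\<^sup>2 \<le> (\<Sum>\<^sub>\<infinity>x\<in>A. (f x)\<^sup>2) * (\<Sum>\<^sub>\<infinity>x\<in>A. (g x)\<^sup>2)"
proof -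
  show s: "(\<lambda>x. \<bar>f x * g x\<bar>) summable_on A"
    using abs_summable_product[of f A g] f g by (simp add: power2_eq_square)
  have "(\<Sum>\<^sub>\<infinity>x\<in>A. \<bar>f x * g x\<bar>) \<le> sqrt ((\<Sum>\<^sub>\<infinity>x\<in>A. (f x)\<^sup>2) * (\<Sum>\<^sub>\<infinity>x\<in>A. (g x)\<^sup>2))"
  proof (rule infsum_le_finite_sums[OF s])
    fix F assume F: "finite F" "F \<subseteq> A"
    have "(\<Sum>x\<in>F. \<bar>f x * g x\<bar>)\<^sup>2 \<le> (\<Sum>x\<in>F. (f x)\<^sup>2) * (\<Sum>x\<in>F. (g x)\<^sup>2)"
      using Cauchy_Schwarz_ineq_sum[of "\<lambda>x. \<bar>f x\<bar>" "\<lambda>x. \<bar>g x\<bar>" F] by (simp add: abs_mult)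
    also have "\<dots> \<le> (\<Sum>\<^sub>\<infinity>x\<in>A. (f x)\<^sup>2) * (\<Sum>\<^sub>\<infinity>x\<in>A. (g x)\<^sup>2)"
      using F f g by (intro mult_mono finite_sum_le_infsum sum_nonneg infsum_nonneg) auto
    finally show "(\<Sum>x\<in>F. \<bar>f x * g x\<bar>) \<le> sqrt ((\<Sum>\<^sub>\<infinity>x\<in>A. (f x)\<^sup>2) * (\<Sum>\<^sub>\<infinity>x\<in>A. (g x)\<^sup>2))"
      by (rule real_le_rsqrt)
  qed
  then have "(\<Sum>\<^sub>\<infinity>x\<in>A. \<bar>f x * g x\<bar>)\<^sup>2 \<le> (sqrt ((\<Sum>\<^sub>\<infinity>x\<in>A. (f x)\<^sup>2) * (\<Sum>\<^sub>\<infinity>x\<in>A. (g x)\<^sup>2)))\<^sup>2"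
    by (intro power_mono infsum_nonneg) auto
  then show "(\<Sum>\<^sub>\<infinity>x\<in>A. \<bar>f x * g x\<bar>)\<^sup>2 \<le> (\<Sum>\<^sub>\<infinity>x\<in>A. (f x)\<^sup>2) * (\<Sum>\<^sub>\<infinity>x\<in>A. (g x)\<^sup>2)"
    by (simp add: infsum_nonneg)
qed

text \<open>Fubini for a product family: for fixed \<open>x\<close> the row of norms sums to
  \<open>norm (f x)\<close> times a constant, which is summable in \<open>x\<close>. Absolute
  summability then allows the double sum to be evaluated row by row.\<close>

lemma has_sum_product:
  fixes f :: "'a \<Rightarrow> 'c :: {real_normed_field, banach}" and g :: "'b \<Rightarrow> 'c"
  assumes f: "(\<lambda>x. norm (f x)) summable_on A" and g: "(\<lambda>y. norm (g y)) summable_on B"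
  shows "(\<lambda>(x, y). norm (f x * g y)) summable_on A \<times> B"
    and "((\<lambda>(x, y). f x * g y) has_sum (infsum f A * infsum g B)) (A \<times> B)"
proof -
  show s: "(\<lambda>(x, y). norm (f x * g y)) summable_on A \<times> B"
  proof (rule summable_on_SigmaI)
    show "((\<lambda>y. case (x, y) of (x, y) \<Rightarrow> norm (f x * g y)) has_sum norm (f x) * (\<Sum>\<^sub>\<infinity>y\<in>B. norm (g y))) B" for x
      using has_sum_cmult_right[OF has_sum_infsum[OF g], of "norm (f x)"] by (simp add: norm_mult)
    show "(\<lambda>x. norm (f x) * (\<Sum>\<^sub>\<infinity>y\<in>B. norm (g y))) summable_on A"
      by (intro summable_on_cmult_left f)
  qed auto
  show "((\<lambda>(x, y). f x * g y) has_sum (infsum f A * infsum g B)) (A \<times> B)"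
  proof (rule has_sum_SigmaI)
    show "((\<lambda>y. case (x, y) of (x, y) \<Rightarrow> f x * g y) has_sum (f x * infsum g B)) B" for x
      using has_sum_cmult_right[OF has_sum_infsum[OF abs_summable_summable[OF g]], of "f x"] by simp
    show "((\<lambda>x. f x * infsum g B) has_sum (infsum f A * infsum g B)) A"
      by (rule has_sum_cmult_left[OF has_sum_infsum[OF abs_summable_summable[OF f]]])
    show "(\<lambda>(x, y). f x * g y) summable_on A \<times> B"
      by (rule abs_summable_summable) (use s in \<open>simp add: case_prod_unfold\<close>)
  qed
qed

section \<open>Convolution of absolutely summable families on an abelian group\<close>

definition convolution :: "('a::ab_group_add \<Rightarrow> 'b::real_normed_field) \<Rightarrow> ('a \<Rightarrow> 'b) \<Rightarrow> 'a \<Rightarrow> 'b" where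
  "convolution f g k = (\<Sum>\<^sub>\<infinity>l. f l * g (k - l))"

text \<open>The shear sending \<open>(k, l)\<close> to \<open>(l, k - l)\<close> is a bijection of
  pairs that turns the product family into the family of convolution terms. Summing that family over
  \<open>l\<close> first and then over \<open>k\<close> gives all three claims.\<close>

lemma
  fixes f g :: "'a::ab_group_add \<Rightarrow> 'c :: {real_normed_field, banach}"
  assumes f: "(\<lambda>x. norm (f x)) summable_on UNIV" and g: "(\<lambda>x. norm (g x)) summable_on UNIV"
  shows abs_summable_convolution_terms: "(\<lambda>l. norm (f l * g (k - l))) summable_on UNIV"
    and abs_summable_convolution: "(\<lambda>k. norm (convolution f g k)) summable_on UNIV"
    and has_sum_convolution: "(convolution f g has_sum (infsum f UNIV * infsum g UNIV)) UNIV"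
proof -
  have bij: "bij_betw (\<lambda>(k, l). (l, k - l)) (UNIV :: ('a \<times> 'a) set) UNIV"
    by (rule bij_betwI[where g = "\<lambda>(l, m). (l + m, l)"]) auto
  have s: "(\<lambda>(k, l). norm (f l * g (k - l))) summable_on UNIV \<times> UNIV"
    using summable_on_reindex_bij_betw[OF bij, of "\<lambda>(x, y). norm (f x * g y)"] has_sum_product(1)[OF f g]
    by (simp add: case_prod_unfold)
  have h: "((\<lambda>(k, l). f l * g (k - l)) has_sum (infsum f UNIV * infsum g UNIV)) (UNIV \<times> UNIV)"
    using has_sum_reindex_bij_betw[OF bij, of "\<lambda>(x, y). f x * g y"] has_sum_product(2)[OF f g]
    by (simp add: case_prod_unfold)
  show t: "(\<lambda>l. norm (f l * g (k - l))) summable_on UNIV" for k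
    using summable_on_SigmaD1[OF s] by simp
  show "(convolution f g has_sum (infsum f UNIV * infsum g UNIV)) UNIV"
  proof (rule has_sum_SigmaD[OF h])
    show "((\<lambda>l. case (k, l) of (k, l) \<Rightarrow> f l * g (k - l)) has_sum convolution f g k) UNIV" for k
      unfolding convolution_def prod.case by (rule has_sum_infsum[OF abs_summable_summable[OF t]])
  qed
  have "(\<lambda>k. \<Sum>\<^sub>\<infinity>l. norm (f l * g (k - l))) summable_on UNIV"
    by (rule summable_on_Sigma_banach[OF s])
  then show "(\<lambda>k. norm (convolution f g k)) summable_on UNIV"
    unfolding convolution_def
    by (rule summable_on_comparison_test) (rule norm_infsum_bound[OF t], simp)
qed

section \<open>The norm \<open>abs1\<close> and convergence of the lattice sum\<close>

lemma abs1_nonneg [simp]: "abs1 k \<ge> 0"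
  by (simp add: abs1_def sum_nonneg)

lemma abs1_zero [simp]: "abs1 0 = 0"
  by (simp add: abs1_def)

lemma abs1_triangle: "abs1 (k + l) \<le> abs1 k + abs1 l"
proof -
  have "abs1 (k + l) \<le> (\<Sum>j\<in>UNIV. of_int \<bar>k $ j\<bar> + of_int \<bar>l $ j\<bar>)"
    unfolding abs1_def by (intro sum_mono) (simp add: abs_triangle_ineq)
  then show ?thesis by (simp add: abs1_def sum.distrib)
qed

lemma component_le_abs1: "of_int \<bar>k $ j\<bar> \<le> abs1 k"
  unfolding abs1_def by (rule member_le_sum) auto

text \<open>Comparison with \<open>real n powr (- 2 * s)\<close> settles the naturals, and evenness
  carries this over to the negative integers. The exponent is real because it will be the quotient
  of \<open>r\<close> by the dimension.\<close>

lemma summable_on_int_powr: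
  assumes "s > 1 / 2"
  shows "(\<lambda>n. (1 + (of_int n)\<^sup>2) powr (- s) :: real) summable_on (UNIV :: int set)"
proof -
  let ?f = "\<lambda>n. (1 + (of_int n)\<^sup>2) powr (- s) :: real"
  have "summable (\<lambda>n. (1 + (real n)\<^sup>2) powr (- s))"
  proof (rule summable_comparison_test)
    show "summable (\<lambda>n. real n powr (- 2 * s))"
      using assms by (simp add: summable_real_powr_iff)
    have "(1 + (real n)\<^sup>2) powr (- s) \<le> real n powr (- 2 * s)" if "n \<ge> 1" for n
    proof -
      have "(1 + (real n)\<^sup>2) powr (- s) \<le> ((real n)\<^sup>2) powr (- s)"
        using that assms by (intro powr_mono2') auto
      also have "\<dots> = real n powr (- 2 * s)"
        using that powr_powr[of "real n" 2 "- s"] by simp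
      finally show ?thesis .
    qed
    then show "\<exists>N. \<forall>n\<ge>N. norm ((1 + (real n)\<^sup>2) powr (- s)) \<le> real n powr (- 2 * s)"
      by auto
  qed
  then have n: "(\<lambda>n. (1 + (real n)\<^sup>2) powr (- s)) summable_on UNIV"
    by (intro summable_nonneg_imp_summable_on) auto
  have "?f summable_on range int" "?f summable_on range (\<lambda>n. - int n)"
    using n by (auto simp: summable_on_reindex inj_on_def o_def)
  then have "?f summable_on (range int \<union> range (\<lambda>n. - int n))"
    by (rule summable_on_union)
  moreover have "z \<in> range int \<union> range (\<lambda>n. - int n)" for z
    by (cases z rule: int_cases2) auto
  then have "range int \<union> range (\<lambda>n. - int n) = UNIV"
    by blast
  ultimately show ?thesis by simp
qed

text \<open>The power \<open>r\<close> is shared equally among the coordinates, each receiving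
  \<open>s = r / d > 1 / 2\<close>. As \<open>1 + (abs1 k)\<^sup>2\<close> dominates
  \<open>1 + (k $ j)\<^sup>2\<close> for every \<open>j\<close>, the term is at most a product of
  one-dimensional terms, whose sum over a cube factorizes.\<close>

lemma summable_on_lattice:
  assumes "real r > real CARD('d::finite) / 2"
  shows "(\<lambda>k :: int ^ 'd. 1 / (1 + (abs1 k)\<^sup>2) ^ r) summable_on UNIV"
proof (rule nonneg_bdd_above_summable_on)
  define s where "s = real r / real CARD('d)"
  have s: "s > 1 / 2"
    using assms by (simp add: s_def field_simps)
  define g :: "int \<Rightarrow> real" where "g n = (1 + (of_int n)\<^sup>2) powr (- s)" for n
  have g: "g summable_on UNIV" and g0: "g n \<ge> 0" for n
    using summable_on_int_powr[OF s] by (simp_all add: g_def[abs_def])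
  have le: "1 / (1 + (abs1 k)\<^sup>2) ^ r \<le> (\<Prod>j\<in>UNIV. g (k $ j))" for k :: "int ^ 'd"
  proof -
    have J: "1 + (abs1 k)\<^sup>2 > 0"
      by (simp add: add_pos_nonneg)
    have "1 / (1 + (abs1 k)\<^sup>2) ^ r = (1 + (abs1 k)\<^sup>2) powr (- real r)"
      by (simp only: powr_minus powr_realpow[OF J] divide_inverse mult_1)
    also have "- real r = real CARD('d) * - s"
      by (simp add: s_def)
    also have "(1 + (abs1 k)\<^sup>2) powr \<dots> = (\<Prod>j\<in>(UNIV::'d set). (1 + (abs1 k)\<^sup>2) powr (- s))"
      using J by (simp only: prod_constant powr_power less_imp_neq[symmetric] not_False_eq_True)
    also have "\<dots> \<le> (\<Prod>j\<in>UNIV. g (k $ j))"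
    proof (intro prod_mono conjI)
      fix j
      have "(of_int (k $ j) :: real)\<^sup>2 \<le> (abs1 k)\<^sup>2"
        using component_le_abs1[of k j] by (intro abs_le_square_iff[THEN iffD1]) simp
      then show "(1 + (abs1 k)\<^sup>2) powr (- s) \<le> g (k $ j)"
        using s unfolding g_def by (intro powr_mono2') (auto simp: add_pos_nonneg)
    qed auto
    finally show ?thesis .
  qed
  show "bdd_above (sum (\<lambda>k :: int ^ 'd. 1 / (1 + (abs1 k)\<^sup>2) ^ r) ` {F. F \<subseteq> UNIV \<and> finite F})"
  proof (rule bdd_aboveI2, safe)
    fix F :: "(int ^ 'd) set" assume F: "finite F"
    \<comment> \<open>\<open>N\<close> collects all coordinates of points of \<open>F\<close>, so
      that \<open>F\<close> embeds into the cube of functions with values in \<open>N\<close>. The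
      sum over that cube is a product of sums over \<open>N\<close>.\<close>
    define N where "N = (\<Union>k\<in>F. range (($) k))"
    have N: "finite N"
      using F by (auto simp: N_def)
    have inj: "inj_on ($) F"
      by (auto simp: inj_on_def vec_eq_iff)
    have "(\<Sum>k\<in>F. 1 / (1 + (abs1 k)\<^sup>2) ^ r) \<le> (\<Sum>k\<in>F. \<Prod>j\<in>UNIV. g (k $ j))"
      by (intro sum_mono le)
    also have "\<dots> = (\<Sum>h\<in>($) ` F. \<Prod>j\<in>UNIV. g (h j))"
      by (simp add: sum.reindex[OF inj])
    also have "\<dots> \<le> (\<Sum>h\<in>PiE (UNIV :: 'd set) (\<lambda>_. N). \<Prod>j\<in>UNIV. g (h j))"
    proof (rule sum_mono2)
      show "finite (PiE (UNIV :: 'd set) (\<lambda>_. N))"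
        using N by (intro finite_PiE) auto
    qed (auto simp: N_def g0 intro: prod_nonneg)
    also have "\<dots> = (\<Prod>j\<in>(UNIV :: 'd set). \<Sum>n\<in>N. g n)"
      using N by (subst prod_sum_PiE) auto
    also have "\<dots> \<le> (\<Prod>j\<in>(UNIV :: 'd set). infsum g UNIV)"
      using N g g0 by (intro prod_mono conjI sum_nonneg finite_sum_le_infsum) auto
    finally show "(\<Sum>k\<in>F. 1 / (1 + (abs1 k)\<^sup>2) ^ r) \<le> infsum g UNIV ^ CARD('d)"
      by simp
  qed
qed auto

section \<open>Weighted convolution inequality\<close>

lemma H_weight_pos [simp]: "H_weight \<rho> r k > 0"
  by (simp add: H_weight_def add_pos_nonneg)

lemma H_weight_nonneg [simp]: "H_weight \<rho> r k \<ge> 0"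
  by (simp add: less_imp_le)

text \<open>The exponential factor is submultiplicative by the triangle inequality and
  \<open>\<rho> \<ge> 0\<close>. For the polynomial factor,
  \<open>1 + (abs1 (l + m))\<^sup>2\<close> is at most \<open>4 * max a b\<close>, and the
  \<open>r\<close>-th power of a maximum is at most the sum of the \<open>r\<close>-th powers;
  division by \<open>a ^ r * b ^ r\<close> leaves the two reciprocals.\<close>

lemma H_weight_ratio_le:
  assumes "\<rho> \<ge> 0"
  shows "H_weight \<rho> r (l + m) / (H_weight \<rho> r l * H_weight \<rho> r m)
           \<le> 4 ^ r * (1 / (1 + (abs1 l)\<^sup>2) ^ r + 1 / (1 + (abs1 m)\<^sup>2) ^ r)"
proof -
  define a b where "a = 1 + (abs1 l)\<^sup>2" and "b = 1 + (abs1 m)\<^sup>2"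
  have a: "a > 0" and b: "b > 0"
    by (auto simp: a_def b_def add_pos_nonneg)
  have "(abs1 (l + m))\<^sup>2 \<le> (abs1 l + abs1 m)\<^sup>2"
    by (intro power_mono abs1_triangle) simp
  also have "\<dots> \<le> 2 * (abs1 l)\<^sup>2 + 2 * (abs1 m)\<^sup>2"
    using zero_le_power2[of "abs1 l - abs1 m"] by (simp add: power2_eq_square algebra_simps)
  finally have "1 + (abs1 (l + m))\<^sup>2 \<le> 2 * a + 2 * b"
    by (simp add: a_def b_def)
  also have "\<dots> \<le> 4 * max a b"
    by simp
  finally have "1 + (abs1 (l + m))\<^sup>2 \<le> 4 * max a b" .
  then have "(1 + (abs1 (l + m))\<^sup>2) ^ r \<le> (4 * max a b) ^ r"
    by (intro power_mono) (auto simp: add_nonneg_nonneg)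
  also have "\<dots> \<le> 4 ^ r * (a ^ r + b ^ r)"
    using a b by (auto simp: power_mult_distrib max_def)
  finally have p: "(1 + (abs1 (l + m))\<^sup>2) ^ r \<le> 4 ^ r * (a ^ r + b ^ r)" .
  have e: "exp (2 * abs1 (l + m) * \<rho>) \<le> exp (2 * abs1 l * \<rho>) * exp (2 * abs1 m * \<rho>)"
    using mult_right_mono[OF abs1_triangle[of l m] assms]
    by (simp add: algebra_simps flip: exp_add)
  have "H_weight \<rho> r (l + m)
      \<le> (exp (2 * abs1 l * \<rho>) * exp (2 * abs1 m * \<rho>)) * (4 ^ r * (a ^ r + b ^ r))"
    unfolding H_weight_def by (intro mult_mono e p) auto
  then have "H_weight \<rho> r (l + m) / (H_weight \<rho> r l * H_weight \<rho> r m)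
      \<le> ((exp (2 * abs1 l * \<rho>) * exp (2 * abs1 m * \<rho>)) * (4 ^ r * (a ^ r + b ^ r)))
          / (H_weight \<rho> r l * H_weight \<rho> r m)"
    by (intro divide_right_mono) auto
  also have "\<dots> = 4 ^ r * (1 / a ^ r + 1 / b ^ r)"
    using a b unfolding H_weight_def a_def[symmetric] b_def[symmetric] by (simp add: field_simps)
  finally show ?thesis by (simp add: a_def b_def)
qed

text \<open>Cauchy-Schwarz: the term is \<open>cmod (a k) * sqrt (H_weight \<rho> r k)\<close> times
  the inverse square root of the polynomial weight, and both factors are square summable. The factor
  \<open>exp (abs1 k * \<rho>)\<close> is the bound for the mode on the closed strip, so the series
  will converge absolutely up to the boundary.\<close>

lemma summable_on_exp_weighted:
  fixes a :: "int ^ 'd \<Rightarrow> complex"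
  assumes r: "real r > real CARD('d) / 2"
    and a: "(\<lambda>k. (cmod (a k))\<^sup>2 * H_weight \<rho> r k) summable_on UNIV"
  shows "(\<lambda>k. cmod (a k) * exp (abs1 k * \<rho>)) summable_on UNIV"
proof -
  have s: "(\<lambda>k :: int ^ 'd. (1 / sqrt ((1 + (abs1 k)\<^sup>2) ^ r))\<^sup>2) summable_on UNIV"
    using summable_on_lattice[OF r] by (simp add: power_divide add_nonneg_nonneg)
  have w: "(cmod (a k) * sqrt (H_weight \<rho> r k))\<^sup>2 = (cmod (a k))\<^sup>2 * H_weight \<rho> r k" for k
    by (simp add: power_mult_distrib)
  have e: "\<bar>cmod (a k) * sqrt (H_weight \<rho> r k) * (1 / sqrt ((1 + (abs1 k)\<^sup>2) ^ r))\<bar>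
      = cmod (a k) * exp (abs1 k * \<rho>)" for k :: "int ^ 'd"
  proof -
    have "sqrt (exp (2 * abs1 k * \<rho>)) = exp (abs1 k * \<rho>)"
      by (rule real_sqrt_unique) (simp_all add: power2_eq_square flip: exp_add)
    moreover have "1 + (abs1 k)\<^sup>2 \<noteq> 0"
      by (simp add: add_nonneg_eq_0_iff)
    ultimately show ?thesis
      by (simp add: H_weight_def real_sqrt_mult abs_mult)
  qed
  show ?thesis
    using infsum_Cauchy_Schwarz(1)[OF a[folded w] s] unfolding e .
qed

corollary summable_on_norm_of_weighted:
  fixes a :: "int ^ 'd \<Rightarrow> complex"
  assumes r: "real r > real CARD('d) / 2" and "\<rho> \<ge> 0"
    and a: "(\<lambda>k. (cmod (a k))\<^sup>2 * H_weight \<rho> r k) summable_on UNIV"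
  shows "(\<lambda>k. cmod (a k)) summable_on UNIV"
  by (rule summable_on_comparison_test[OF summable_on_exp_weighted[OF r a]])
    (use \<open>\<rho> \<ge> 0\<close> in \<open>auto intro!: mult_right_le_one_le simp: mult_le_cancel_left1\<close>)

lemma weighted_convolution:
  fixes a b :: "int ^ 'd \<Rightarrow> complex"
  assumes r: "real r > real CARD('d) / 2" and \<rho>: "\<rho> \<ge> 0"
    and a: "(\<lambda>k. (cmod (a k))\<^sup>2 * H_weight \<rho> r k) summable_on UNIV"
    and b: "(\<lambda>k. (cmod (b k))\<^sup>2 * H_weight \<rho> r k) summable_on UNIV"
  shows "(\<lambda>k. (cmod (convolution a b k))\<^sup>2 * H_weight \<rho> r k) summable_on UNIV" (is ?thesis1)
    and "(\<Sum>\<^sub>\<infinity>k. (cmod (convolution a b k))\<^sup>2 * H_weight \<rho> r k)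
       \<le> 2 * 4 ^ r * (\<Sum>\<^sub>\<infinity>k :: int ^ 'd. 1 / (1 + (abs1 k)\<^sup>2) ^ r)
          * (\<Sum>\<^sub>\<infinity>k. (cmod (a k))\<^sup>2 * H_weight \<rho> r k) * (\<Sum>\<^sub>\<infinity>k. (cmod (b k))\<^sup>2 * H_weight \<rho> r k)" (is ?thesis2)
proof -
  let ?w = "H_weight \<rho> r :: int ^ 'd \<Rightarrow> real"
  define J where "J k = 1 / (1 + (abs1 k)\<^sup>2) ^ r" for k :: "int ^ 'd"
  define S where "S = infsum J UNIV"
  define A B where "A k = (cmod (a k))\<^sup>2 * ?w k" and "B k = (cmod (b k))\<^sup>2 * ?w k" for k
  have J: "J summable_on UNIV" and J0: "J k \<ge> 0" for k
    using summable_on_lattice[OF r] by (auto simp: J_def[abs_def])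
  have A: "A summable_on UNIV" and A0: "A k \<ge> 0" and B: "B summable_on UNIV" and B0: "B k \<ge> 0" for k
    using a b by (auto simp: A_def[abs_def] B_def[abs_def])
  have AB: "(\<lambda>l. A l * B (k - l)) summable_on UNIV" for k
    using abs_summable_convolution_terms[of A B k] A B A0 B0 by simp
  have hs: "(convolution A B has_sum (infsum A UNIV * infsum B UNIV)) UNIV"
    using has_sum_convolution[of A B] A B A0 B0 by simp
  have key: "(cmod (convolution a b k))\<^sup>2 * ?w k \<le> 2 * 4 ^ r * S * convolution A B k" for k
  proof -
    \<comment> \<open>The reflection of \<open>l\<close> to \<open>k - l\<close> shows that the
      shifted sum of \<open>J\<close> is again \<open>S\<close>, whatever \<open>k\<close> is. This
      makes the bound uniform in \<open>k\<close> and explains the factor 2.\<close>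
    have bij: "bij_betw (\<lambda>l. k - l) UNIV (UNIV :: (int ^ 'd) set)"
      by (rule bij_betwI[where g = "\<lambda>l. k - l"]) auto
    have J': "(\<lambda>l. J (k - l)) summable_on UNIV" and S': "(\<Sum>\<^sub>\<infinity>l. J (k - l)) = S"
      using J by (simp_all add: S_def summable_on_reindex_bij_betw[OF bij] infsum_reindex_bij_betw[OF bij])
    \<comment> \<open>\<open>Q l\<close> cancels the weights contained in \<open>A l\<close> and
      \<open>B (k - l)\<close>, so that Cauchy-Schwarz applies to
      \<open>sqrt (A l * B (k - l))\<close> and \<open>Q l\<close>. The terms
      \<open>(Q l)\<^sup>2 * ?w k\<close> are exactly the weight ratios estimated before.\<close>
    define Q where "Q l = sqrt (1 / (?w l * ?w (k - l)))" for l
    have Q2: "(Q l)\<^sup>2 = 1 / (?w l * ?w (k - l))" for l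
      by (simp add: Q_def)
    have Qle: "(Q l)\<^sup>2 * ?w k \<le> 4 ^ r * (J l + J (k - l))" for l
      using H_weight_ratio_le[OF \<rho>, of r l "k - l"] by (simp add: Q2 J_def)
    have JJ: "(\<lambda>l. 4 ^ r * (J l + J (k - l))) summable_on UNIV"
      by (intro summable_on_cmult_right summable_on_add J J')
    have Qsw: "(\<lambda>l. (Q l)\<^sup>2 * ?w k) summable_on UNIV"
      by (rule summable_on_comparison_test[OF JJ Qle]) auto
    then have Qs: "(\<lambda>l. (Q l)\<^sup>2) summable_on UNIV"
      using summable_on_cmult_left[OF Qsw, of "1 / ?w k"] by (simp add: less_imp_neq[symmetric])
    have "(\<Sum>\<^sub>\<infinity>l. (Q l)\<^sup>2) * ?w k = (\<Sum>\<^sub>\<infinity>l. (Q l)\<^sup>2 * ?w k)"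
      by (rule infsum_cmult_left[symmetric]) (use Qs in auto)
    also have "\<dots> \<le> (\<Sum>\<^sub>\<infinity>l. 4 ^ r * (J l + J (k - l)))"
      by (rule infsum_mono[OF Qsw JJ Qle])
    also have "\<dots> = 2 * 4 ^ r * S"
      by (subst infsum_cmult_right, intro summable_on_add J J')
        (simp add: infsum_add[OF J J'] S' flip: S_def)
    finally have Qsum: "(\<Sum>\<^sub>\<infinity>l. (Q l)\<^sup>2) * ?w k \<le> 2 * 4 ^ r * S" .
    have P2: "(sqrt (A l * B (k - l)))\<^sup>2 = A l * B (k - l)" for l
      by (simp add: A0 B0)
    have PQ: "\<bar>sqrt (A l * B (k - l)) * Q l\<bar> = cmod (a l * b (k - l))" for l
    proof -
      have "A l * B (k - l) * (1 / (?w l * ?w (k - l))) = (cmod (a l * b (k - l)))\<^sup>2"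
        by (simp add: A_def B_def norm_mult power_mult_distrib less_imp_neq[symmetric])
      then show ?thesis
        unfolding Q_def real_sqrt_mult[symmetric] by simp
    qed
    note cs = infsum_Cauchy_Schwarz[of "\<lambda>l. sqrt (A l * B (k - l))" UNIV Q, unfolded P2 PQ, OF AB Qs]
    have "(cmod (convolution a b k))\<^sup>2 * ?w k \<le> (\<Sum>\<^sub>\<infinity>l. cmod (a l * b (k - l)))\<^sup>2 * ?w k"
      unfolding convolution_def
      by (intro mult_right_mono power_mono norm_infsum_bound cs(1)) auto
    also have "\<dots> \<le> (convolution A B k * (\<Sum>\<^sub>\<infinity>l. (Q l)\<^sup>2)) * ?w k"
      using cs(2) by (intro mult_right_mono) (auto simp: convolution_def)
    also have "\<dots> = convolution A B k * ((\<Sum>\<^sub>\<infinity>l. (Q l)\<^sup>2) * ?w k)"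
      by simp
    also have "\<dots> \<le> convolution A B k * (2 * 4 ^ r * S)"
      using A0 B0 by (intro mult_left_mono Qsum) (auto simp: convolution_def intro!: infsum_nonneg)
    finally show ?thesis by (simp add: mult.commute)
  qed
  have h: "((\<lambda>k. 2 * 4 ^ r * S * convolution A B k) has_sum
      (2 * 4 ^ r * S * (infsum A UNIV * infsum B UNIV))) UNIV"
    by (intro has_sum_cmult_right hs)
  show c: ?thesis1
    by (rule summable_on_comparison_test[OF has_sum_imp_summable[OF h] key]) auto
  show ?thesis2
    using has_sum_mono[OF has_sum_infsum[OF c] h key]
    unfolding S_def J_def[abs_def] A_def[abs_def] B_def[abs_def] by (simp add: mult.assoc)
qed

section \<open>Absolutely convergent Fourier series\<close>

abbreviation cell_measure :: "(real ^ 'd) measure" where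
  "cell_measure \<equiv> lebesgue_on period_cell"

lemma finite_measure_cell: "finite_measure (cell_measure :: (real ^ 'd) measure)"
  unfolding period_cell_def by (intro finite_measure_lebesgue_on lmeasurable_cbox)

lemma period_cell_sets [measurable, simp]: "period_cell \<in> sets lebesgue"
  by (simp add: period_cell_def)

lemma period_cell_iff: "x \<in> period_cell \<longleftrightarrow> (\<forall>j. x $ j \<in> {0..2 * pi})"
  by (auto simp: period_cell_def mem_box_cart)

text \<open>Turns the set integrals of the definitions into integrals over a finite measure, for
  which essentially bounded measurable functions are integrable.\<close>

lemma set_integral_period_cell:
  fixes f :: "real ^ 'd \<Rightarrow> 'b :: {banach, second_countable_topology}"
  shows "(LINT x:period_cell|lebesgue. f x) = (LINT x|cell_measure. f x)"
  by (simp add: set_lebesgue_integral_def integral_restrict_space)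

lemma fourier_mode_real_point:
  "fourier_mode k (real_point x) = (\<Prod>j\<in>UNIV. exp (\<i> * of_int (k $ j) * of_real (x $ j)))"
  by (simp add: fourier_mode_def real_point_def sum_distrib_left exp_sum mult.assoc)

lemma fourier_mode_add: "fourier_mode (k + l) x = fourier_mode k x * fourier_mode l x"
  by (simp add: fourier_mode_def algebra_simps sum.distrib flip: exp_add)

lemma norm_fourier_mode_real_point [simp]: "cmod (fourier_mode k (real_point x)) = 1"
  by (simp add: fourier_mode_real_point norm_exp_eq_Re flip: prod_norm)

text \<open>The modulus is the exponential of minus the sum of \<open>k $ j\<close> times
  \<open>Im (x $ j)\<close>, and each imaginary part is at most \<open>\<rho>\<close> in absolute
  value.\<close>

lemma norm_fourier_mode_le:
  assumes "x \<in> strip \<rho>"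
  shows "cmod (fourier_mode k x) \<le> exp (abs1 k * \<rho>)"
proof -
  have "- (\<Sum>j\<in>UNIV. of_int (k $ j) * Im (x $ j)) \<le> (\<Sum>j\<in>UNIV. of_int \<bar>k $ j\<bar> * \<rho>)"
    unfolding sum_negf[symmetric]
  proof (rule sum_mono)
    fix j
    have "- (of_int (k $ j) * Im (x $ j)) \<le> \<bar>of_int (k $ j)\<bar> * \<bar>Im (x $ j)\<bar>"
      by (metis abs_ge_minus_self abs_mult)
    also have "\<dots> \<le> of_int \<bar>k $ j\<bar> * \<rho>"
      using assms by (auto simp: strip_def intro!: mult_left_mono)
    finally show "- (of_int (k $ j) * Im (x $ j)) \<le> of_int \<bar>k $ j\<bar> * \<rho>" .
  qed
  then show ?thesis
    by (simp add: fourier_mode_def abs1_def norm_exp_eq_Re sum_distrib_right)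
qed

lemma continuous_fourier_mode [continuous_intros]:
  "continuous_on A (\<lambda>x. fourier_mode k (real_point x))"
  unfolding fourier_mode_real_point by (intro continuous_intros)

lemma integral_exp_period:
  "(LINT t|lborel. indicator {0..2 * pi} t *\<^sub>R exp (\<i> * of_int n * of_real t))
     = (if n = 0 then of_real (2 * pi) else 0)"
proof (cases "n = 0")
  case True
  then show ?thesis by (simp add: scaleR_conv_of_real)
next
  case False
  let ?F = "\<lambda>t. exp (\<i> * of_int n * of_real t) / (\<i> * of_int n)"
  have "(?F has_vector_derivative exp (\<i> * of_int n * of_real t)) (at t within {0..2 * pi})" for t
    using False by (auto intro!: derivative_eq_intros has_vector_derivative_real_field simp: field_simps)
  then have "(LINT t|lborel. indicator {0..2 * pi} t *\<^sub>R exp (\<i> * of_int n * of_real t)) = ?F (2 * pi) - ?F 0"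
    by (intro integral_FTC_atLeastAtMost continuous_intros) auto
  also have "exp (\<i> * of_int n * of_real (2 * pi)) = 1"
    using exp_integer_2pi[of "of_int n"] by (simp add: mult_ac)
  finally show ?thesis using False by simp
qed

text \<open>Bridges two indexings: Lebesgue measure is a product over \<open>Basis\<close>, while
  the modes are products over the coordinate type.\<close>

lemma prod_Basis_vec:
  "(\<Prod>b\<in>(Basis :: (real ^ 'd) set). f (axis_index b)) = (\<Prod>j\<in>UNIV. f j)"
proof -
  have B: "(Basis :: (real ^ 'd) set) = range (\<lambda>j. axis j 1)"
    by (auto simp: Basis_vec_def)
  have "inj (\<lambda>j. axis j (1 :: real) :: real ^ 'd)"
    by (simp add: inj_on_def axis_eq_axis)
  then show ?thesis
    unfolding B by (simp add: prod.reindex)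
qed

text \<open>Orthogonality of the modes: by Fubini the integral is a product of integrals over one
  period, and a single nonzero frequency makes one factor vanish.\<close>

lemma integral_fourier_mode:
  fixes m :: "int ^ 'd"
  shows "(LINT x|cell_measure. fourier_mode m (real_point x)) = (if m = 0 then of_real ((2 * pi) ^ CARD('d)) else 0)"
proof -
  \<comment> \<open>The indicator is built into each factor, so that the integral over the cell
    becomes the integral of a product function over the whole space.\<close>
  define h where "h j t = indicator {0..2 * pi} t *\<^sub>R exp (\<i> * of_int (m $ j) * of_real t)" for j t
  let ?H = "\<lambda>x :: real ^ 'd. \<Prod>b\<in>Basis. h (axis_index b) (x \<bullet> b)"
  have hm [measurable]: "h j \<in> borel_measurable borel" for j
    unfolding h_def by measurable
  have hi: "integrable lborel (h j)" for j
    unfolding h_def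
    by (rule borel_integrable_atLeastAtMost'[unfolded set_integrable_def]) (intro continuous_intros)
  have H: "?H x = (\<Prod>j\<in>UNIV. h j (x $ j))" for x :: "real ^ 'd"
  proof -
    have "?H x = (\<Prod>b\<in>(Basis :: (real ^ 'd) set). h (axis_index b) (x $ axis_index b))"
      by (intro prod.cong refl) (metis axis_index cart_eq_inner_axis)
    then show ?thesis by (simp add: prod_Basis_vec[of "\<lambda>j. h j (x $ j)"])
  qed
  have ind: "indicator period_cell x *\<^sub>R fourier_mode m (real_point x) = ?H x" for x
  proof -
    have "(\<Prod>j\<in>UNIV. indicator {0..2 * pi} (x $ j)) = (indicator period_cell x :: real)"
      by (auto simp: indicator_def period_cell_iff)
    then show ?thesis
      unfolding H unfolding h_def fourier_mode_real_point scaleR_conv_of_real prod.distrib of_real_prod[symmetric] by simp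
  qed
  interpret product_sigma_finite "\<lambda>_ :: real ^ 'd. lborel :: real measure"
    by standard
  have "(LINT x|cell_measure. fourier_mode m (real_point x)) = (LINT x|lebesgue. ?H x)"
    by (simp add: integral_restrict_space ind)
  \<comment> \<open>Lebesgue measure completes \<open>lborel\<close>, and the integrand is Borel.
    Next, \<open>lborel\<close> is written as the image of a product measure under the coordinate
    map.\<close>
  also have "\<dots> = (LINT x|lborel. ?H x)"
    by (rule integral_completion) measurable
  also have "\<dots> = (LINT f|(\<Pi>\<^sub>M b\<in>Basis. lborel). ?H (\<Sum>b\<in>Basis. f b *\<^sub>R b))"
    by (subst lborel_eq, rule integral_distr) measurable
  also have "\<dots> = (LINT f|(\<Pi>\<^sub>M b\<in>Basis. lborel). (\<Prod>b\<in>(Basis :: (real ^ 'd) set). h (axis_index b) (f b)))"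
    by simp
  also have "\<dots> = (\<Prod>b\<in>(Basis :: (real ^ 'd) set). LINT t|lborel. h (axis_index b) t)"
    by (rule product_integral_prod) (auto intro: hi)
  also have "\<dots> = (\<Prod>j\<in>UNIV. LINT t|lborel. h j t)"
    by (rule prod_Basis_vec)
  also have "\<dots> = (\<Prod>j\<in>UNIV. if m $ j = 0 then of_real (2 * pi) else 0)"
    by (simp add: h_def integral_exp_period del: of_real_mult)
  also have "\<dots> = (if m = 0 then of_real ((2 * pi) ^ CARD('d)) else 0)"
    by (auto simp: vec_eq_iff prod_zero_iff)
  finally show ?thesis .
qed

section \<open>Fourier coefficients and uniform control of the series\<close>

lemma fourier_coeff_eq:
  "fourier_coeff u k
     = (LINT x|cell_measure. u (real_point x) * fourier_mode (- k) (real_point (x :: real ^ 'd)))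
         / of_real ((2 * pi) ^ CARD('d))"
  unfolding fourier_coeff_def set_integral_period_cell ..

lemma L2_fourier_expansion_iff:
  fixes u :: "complex ^ 'd \<Rightarrow> complex"
  shows "L2_fourier_expansion u \<longleftrightarrow>
     (\<lambda>x. u (real_point x)) \<in> borel_measurable cell_measure \<and>
     integrable cell_measure (\<lambda>x. (cmod (u (real_point x)))\<^sup>2) \<and>
     ((\<lambda>K. LINT x|cell_measure.
         (cmod (u (real_point x) - (\<Sum>k\<in>K. fourier_coeff u k * fourier_mode k (real_point x))))\<^sup>2)
       \<longlongrightarrow> 0) (finite_subsets_at_top UNIV)"
  unfolding L2_fourier_expansion_def set_integral_period_cell set_borel_measurable_def set_integrable_def
  by (simp add: borel_measurable_restrict_space_iff integrable_restrict_space)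

lemma fourier_mode_measurable [measurable]:
  "(\<lambda>x. fourier_mode k (real_point x)) \<in> borel_measurable cell_measure"
  by (intro continuous_imp_measurable_on_sets_lebesgue continuous_intros) simp

text \<open>For summable \<open>c\<close> and finite \<open>K\<close> this is the mass of
  \<open>c\<close> outside \<open>K\<close>. The difference form makes the limit immediate, and
  \<open>K = {}\<close> gives the full sum, used as a uniform bound.\<close>

definition sum_tail :: "('a \<Rightarrow> complex) \<Rightarrow> 'a set \<Rightarrow> real" where
  "sum_tail c K = (\<Sum>\<^sub>\<infinity>k. cmod (c k)) - (\<Sum>k\<in>K. cmod (c k))"

lemma sum_tail_tendsto:
  assumes "(\<lambda>k. cmod (c k)) summable_on UNIV"
  shows "(sum_tail c \<longlongrightarrow> 0) (finite_subsets_at_top UNIV)"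
  using tendsto_diff[OF tendsto_const infsum_tendsto[OF assms], of "infsum (\<lambda>k. cmod (c k)) UNIV"]
  by (simp add: sum_tail_def[abs_def])

lemma sum_tail_nonneg:
  assumes "(\<lambda>k. cmod (c k)) summable_on UNIV" "finite K"
  shows "sum_tail c K \<ge> 0"
  using finite_sum_le_infsum[OF assms] by (simp add: sum_tail_def)

text \<open>Modes have modulus one at real points, so the remainder is dominated by the coefficients
  outside \<open>K\<close>. The bound does not depend on \<open>x\<close>.\<close>

lemma fourier_series_tail_le:
  assumes c: "(\<lambda>k. cmod (c k)) summable_on UNIV" and K: "finite K"
    and s: "((\<lambda>k. c k * fourier_mode k (real_point x)) has_sum z) UNIV"
  shows "cmod (z - (\<Sum>k\<in>K. c k * fourier_mode k (real_point x))) \<le> sum_tail c K"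
proof (rule norm_has_sum_bound)
  show "((\<lambda>k. c k * fourier_mode k (real_point x)) has_sum
      (z - (\<Sum>k\<in>K. c k * fourier_mode k (real_point x)))) (UNIV - K)"
    by (intro has_sum_Diff s has_sum_finite K) auto
  have "((\<lambda>k. cmod (c k)) has_sum sum_tail c K) (UNIV - K)"
    unfolding sum_tail_def by (intro has_sum_Diff has_sum_infsum c has_sum_finite K) auto
  then show "((\<lambda>k. cmod (c k * fourier_mode k (real_point x))) has_sum sum_tail c K) (UNIV - K)"
    by (simp add: norm_mult)
qed

lemma fourier_series_summable:
  assumes "(\<lambda>k. cmod (c k)) summable_on UNIV"
  shows "(\<lambda>k. c k * fourier_mode k (real_point x)) summable_on UNIV"
  by (rule abs_summable_summable) (use assms in \<open>simp add: norm_mult\<close>)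

text \<open>Uniform limit of trigonometric polynomials, by the Weierstrass M-test; it supplies
  measurability of the sum.\<close>

lemma continuous_fourier_series:
  assumes c: "(\<lambda>k. cmod (c k)) summable_on UNIV"
  shows "continuous_on UNIV (\<lambda>x. \<Sum>\<^sub>\<infinity>k. c k * fourier_mode k (real_point x))"
proof (rule uniform_limit_theorem)
  show "uniform_limit UNIV (\<lambda>K x. \<Sum>k\<in>K. c k * fourier_mode k (real_point x))
      (\<lambda>x. \<Sum>\<^sub>\<infinity>k. c k * fourier_mode k (real_point x)) (finite_subsets_at_top UNIV)"
    by (rule Weierstrass_m_test_general[OF _ c]) (simp add: norm_mult)
  show "\<forall>\<^sub>F K in finite_subsets_at_top UNIV.
      continuous_on UNIV (\<lambda>x. \<Sum>k\<in>K. c k * fourier_mode k (real_point x))"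
    by (intro always_eventually allI continuous_intros)
qed simp

text \<open>Against a mode, a partial sum with \<open>k\<close> in \<open>K\<close> integrates
  exactly to \<open>c k\<close> times the cell volume by orthogonality, and the error is at most a
  multiple of \<open>sum_tail c K\<close>. The squared tail bound gives the L2 convergence. Equality
  almost everywhere suffices, since only integrals are involved.\<close>

lemma
  fixes u :: "complex ^ 'd \<Rightarrow> complex"
  assumes c: "(\<lambda>k. cmod (c k)) summable_on UNIV"
    and u [measurable]: "(\<lambda>x. u (real_point x)) \<in> borel_measurable cell_measure"
    and s: "AE x in cell_measure. ((\<lambda>k. c k * fourier_mode k (real_point x)) has_sum u (real_point x)) UNIV"
  shows fourier_coeff_of_series: "fourier_coeff u = c"
    and L2_fourier_expansion_of_series: "L2_fourier_expansion u"
proof -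
  interpret finite_measure "cell_measure :: (real ^ 'd) measure"
    by (rule finite_measure_cell)
  define V where "V = measure (cell_measure :: (real ^ 'd) measure) (space cell_measure)"
  have tail: "AE x in cell_measure. cmod (u (real_point x) - (\<Sum>k\<in>K. c k * fourier_mode k (real_point x))) \<le> sum_tail c K"
    if "finite K" for K
    using s by eventually_elim (rule fourier_series_tail_le[OF c that])
  have ub: "AE x in cell_measure. cmod (u (real_point x)) \<le> sum_tail c {}"
    using tail[of "{}"] by simp
  have ui: "integrable cell_measure (\<lambda>x. u (real_point x) * fourier_mode k (real_point x))" for k
    by (rule integrable_const_bound[where B = "sum_tail c {}"])
      (use ub in \<open>auto simp: norm_mult\<close>)
  have mi: "integrable cell_measure (\<lambda>x. fourier_mode k (real_point x))" for k :: "int ^ 'd"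
    by (rule integrable_const_bound[where B = 1]) auto
  have coeff: "fourier_coeff u k = c k" for k
  proof -
    let ?T = "of_real ((2 * pi) ^ CARD('d)) :: complex"
    have "cmod (?T * (fourier_coeff u k - c k)) \<le> V * sum_tail c K" if K: "finite K" "k \<in> K" for K
    proof -
      have e: "(u (real_point x) - (\<Sum>l\<in>K. c l * fourier_mode l (real_point x))) * fourier_mode (- k) (real_point x)
          = u (real_point x) * fourier_mode (- k) (real_point x) - (\<Sum>l\<in>K. c l * fourier_mode (l - k) (real_point x))" for x
        by (simp add: left_diff_distrib sum_distrib_right mult.assoc flip: fourier_mode_add)
      have "(LINT x|cell_measure. (u (real_point x) - (\<Sum>l\<in>K. c l * fourier_mode l (real_point x))) * fourier_mode (- k) (real_point x))
          = ?T * fourier_coeff u k - (\<Sum>l\<in>K. c l * (if l - k = 0 then ?T else 0))"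
        unfolding e by (simp add: ui mi fourier_coeff_eq integral_fourier_mode del: right_minus_eq)
      also have "(\<Sum>l\<in>K. c l * (if l - k = 0 then ?T else 0)) = c k * ?T"
        using K by (simp add: if_distrib sum.delta cong: if_cong)
      finally have "?T * (fourier_coeff u k - c k)
          = (LINT x|cell_measure. (u (real_point x) - (\<Sum>l\<in>K. c l * fourier_mode l (real_point x))) * fourier_mode (- k) (real_point x))"
        by (simp add: algebra_simps)
      also have "cmod \<dots> \<le> (LINT x|cell_measure. cmod ((u (real_point x) - (\<Sum>l\<in>K. c l * fourier_mode l (real_point x))) * fourier_mode (- k) (real_point x)))"
        by (rule integral_norm_bound)
      also have "\<dots> \<le> (LINT x|(cell_measure :: (real ^ 'd) measure). sum_tail c K)"
        by (rule integral_mono_AE') (use tail[OF K(1)] sum_tail_nonneg[OF c K(1)] in \<open>auto simp: norm_mult\<close>)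
      finally show ?thesis by (simp add: V_def)
    qed
    \<comment> \<open>Eventually \<open>K\<close> contains \<open>k\<close>; the left side does not
      depend on \<open>K\<close>, so it is bounded by the limit 0.\<close>
    then have "\<forall>\<^sub>F K in finite_subsets_at_top UNIV. cmod (?T * (fourier_coeff u k - c k)) \<le> V * sum_tail c K"
      unfolding eventually_finite_subsets_at_top by (intro exI[of _ "{k}"]) auto
    moreover have "((\<lambda>K. V * sum_tail c K) \<longlongrightarrow> V * 0) (finite_subsets_at_top UNIV)"
      by (intro tendsto_intros sum_tail_tendsto c)
    ultimately have "cmod (?T * (fourier_coeff u k - c k)) \<le> V * 0"
      by (intro tendsto_lowerbound[where f = "\<lambda>K. V * sum_tail c K"]) auto
    then show ?thesis by simp
  qed
  then show eq: "fourier_coeff u = c" by (rule ext)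
  show "L2_fourier_expansion u"
    unfolding L2_fourier_expansion_iff eq
  proof (intro conjI u)
    show "integrable cell_measure (\<lambda>x. (cmod (u (real_point x)))\<^sup>2)"
      by (rule integrable_const_bound[where B = "(sum_tail c {})\<^sup>2"])
        (use ub in \<open>auto elim!: eventually_mono intro: power_mono\<close>)
    have "(LINT x|cell_measure. (cmod (u (real_point x) - (\<Sum>k\<in>K. c k * fourier_mode k (real_point x))))\<^sup>2)
        \<le> V * (sum_tail c K)\<^sup>2" if K: "finite K" for K
    proof -
      have "(LINT x|cell_measure. (cmod (u (real_point x) - (\<Sum>k\<in>K. c k * fourier_mode k (real_point x))))\<^sup>2)
          \<le> (LINT x|(cell_measure :: (real ^ 'd) measure). (sum_tail c K)\<^sup>2)"
        by (rule integral_mono_AE') (use tail[OF K] in \<open>auto elim!: eventually_mono intro: power_mono\<close>)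
      then show ?thesis by (simp add: V_def)
    qed
    then have le: "\<forall>\<^sub>F K in finite_subsets_at_top UNIV.
       (LINT x|cell_measure. (cmod (u (real_point x) - (\<Sum>k\<in>K. c k * fourier_mode k (real_point x))))\<^sup>2)
        \<le> V * (sum_tail c K)\<^sup>2"
      by (intro eventually_finite_subsets_at_top_weakI) auto
    have lim: "((\<lambda>K. V * (sum_tail c K)\<^sup>2) \<longlongrightarrow> 0) (finite_subsets_at_top UNIV)"
      by (auto intro!: tendsto_eq_intros sum_tail_tendsto[OF c])
    show "((\<lambda>K. LINT x|cell_measure. (cmod (u (real_point x) - (\<Sum>k\<in>K. c k * fourier_mode k (real_point x))))\<^sup>2)
        \<longlongrightarrow> 0) (finite_subsets_at_top UNIV)"
      by (rule tendsto_sandwich[OF _ le tendsto_const lim]) simp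
  qed
qed

text \<open>The partial sums converge to \<open>u\<close> in L2 and, by absolute summability,
  uniformly to a function \<open>U\<close>. Comparing both with the same partial sum shows that the
  integral of the squared distance of \<open>u\<close> and \<open>U\<close> is zero.\<close>

lemma L2_fourier_expansion_AE_has_sum:
  fixes u :: "complex ^ 'd \<Rightarrow> complex"
  assumes u: "L2_fourier_expansion u" and c: "(\<lambda>k. cmod (fourier_coeff u k)) summable_on UNIV"
  shows "AE x in cell_measure. ((\<lambda>k. fourier_coeff u k * fourier_mode k (real_point x)) has_sum u (real_point x)) UNIV"
proof -
  interpret finite_measure "cell_measure :: (real ^ 'd) measure"
    by (rule finite_measure_cell)
  define V where "V = measure (cell_measure :: (real ^ 'd) measure) (space cell_measure)"
  define c where "c = fourier_coeff u"
  define U where "U x = (\<Sum>\<^sub>\<infinity>k. c k * fourier_mode k (real_point x))" for x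
  define S where "S K x = (\<Sum>k\<in>K. c k * fourier_mode k (real_point x))" for K x
  note c = c[folded c_def]
  have U: "((\<lambda>k. c k * fourier_mode k (real_point x)) has_sum U x) UNIV" for x
    unfolding U_def by (intro has_sum_infsum fourier_series_summable c)
  have u_meas [measurable]: "(\<lambda>x. u (real_point x)) \<in> borel_measurable cell_measure"
    and u2: "integrable cell_measure (\<lambda>x. (cmod (u (real_point x)))\<^sup>2)"
    and lim: "((\<lambda>K. LINT x|cell_measure. (cmod (u (real_point x) - S K x))\<^sup>2) \<longlongrightarrow> 0) (finite_subsets_at_top UNIV)"
    using u by (simp_all add: L2_fourier_expansion_iff c_def S_def)
  have U_meas [measurable]: "U \<in> borel_measurable cell_measure"
    unfolding U_def[abs_def]
    by (intro continuous_imp_measurable_on_sets_lebesgue continuous_on_subset[OF continuous_fourier_series[OF c]]) auto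
  have S_meas [measurable]: "S K \<in> borel_measurable cell_measure" for K
    unfolding S_def[abs_def] by measurable
  have US: "cmod (U x - S K x) \<le> sum_tail c K" if "finite K" for K x
    unfolding S_def by (rule fourier_series_tail_le[OF c that U])
  \<comment> \<open>This elementary bound takes the place of the triangle inequality in L2.\<close>
  have sq: "(cmod (v - w))\<^sup>2 \<le> 2 * (cmod v)\<^sup>2 + 2 * (cmod w)\<^sup>2" for v w :: complex
  proof -
    have "(cmod (v - w))\<^sup>2 \<le> (cmod v + cmod w)\<^sup>2"
      by (intro power_mono norm_triangle_ineq4) simp
    also have "\<dots> \<le> 2 * (cmod v)\<^sup>2 + 2 * (cmod w)\<^sup>2"
      using zero_le_power2[of "cmod v - cmod w"] by (simp add: power2_eq_square algebra_simps)
    finally show ?thesis .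
  qed
  \<comment> \<open>Needed both for the limit \<open>U\<close> and for each partial sum
    \<open>S K\<close>, which are bounded.\<close>
  have uv: "integrable cell_measure (\<lambda>x. (cmod (u (real_point x) - v x))\<^sup>2)"
    if v [measurable]: "v \<in> borel_measurable cell_measure" and B: "\<And>x. cmod (v x) \<le> B" for v B
  proof (rule Bochner_Integration.integrable_bound)
    show "integrable cell_measure (\<lambda>x. 2 * (cmod (u (real_point x)))\<^sup>2 + 2 * B\<^sup>2)"
      using u2 by simp
    have "(cmod (u (real_point x) - v x))\<^sup>2 \<le> 2 * (cmod (u (real_point x)))\<^sup>2 + 2 * B\<^sup>2" for x
      using sq[of "u (real_point x)" "v x"] power_mono[OF B[of x], of 2] by simp
    then show "AE x in cell_measure. norm ((cmod (u (real_point x) - v x))\<^sup>2)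
        \<le> norm (2 * (cmod (u (real_point x)))\<^sup>2 + 2 * B\<^sup>2)"
      by simp
  qed measurable
  have Sb: "cmod (S K x) \<le> (\<Sum>k\<in>K. cmod (c k))" for K x
    unfolding S_def by (rule sum_norm_le) (simp add: norm_mult)
  have Ub: "cmod (U x) \<le> sum_tail c {}" for x
    using US[of "{}" x] by (simp add: S_def)
  have "(LINT x|cell_measure. (cmod (u (real_point x) - U x))\<^sup>2)
      \<le> 2 * (LINT x|cell_measure. (cmod (u (real_point x) - S K x))\<^sup>2) + 2 * (V * (sum_tail c K)\<^sup>2)"
    if K: "finite K" for K
  proof -
    have "(LINT x|cell_measure. (cmod (u (real_point x) - U x))\<^sup>2)
        \<le> (LINT x|cell_measure. 2 * (cmod (u (real_point x) - S K x))\<^sup>2 + 2 * (sum_tail c K)\<^sup>2)"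
    proof (rule integral_mono)
      fix x
      show "(cmod (u (real_point x) - U x))\<^sup>2 \<le> 2 * (cmod (u (real_point x) - S K x))\<^sup>2 + 2 * (sum_tail c K)\<^sup>2"
        using sq[of "u (real_point x) - S K x" "U x - S K x"] power_mono[OF US[OF K, of x], of 2] by simp
    qed (use uv[OF U_meas Ub] uv[OF S_meas Sb] in auto)
    also have "\<dots> = 2 * (LINT x|cell_measure. (cmod (u (real_point x) - S K x))\<^sup>2) + 2 * (V * (sum_tail c K)\<^sup>2)"
      using uv[OF S_meas Sb] by (simp add: V_def)
    finally show ?thesis .
  qed
  then have "\<forall>\<^sub>F K in finite_subsets_at_top UNIV. (LINT x|cell_measure. (cmod (u (real_point x) - U x))\<^sup>2)
      \<le> 2 * (LINT x|cell_measure. (cmod (u (real_point x) - S K x))\<^sup>2) + 2 * (V * (sum_tail c K)\<^sup>2)"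
    by (intro eventually_finite_subsets_at_top_weakI) auto
  moreover have "((\<lambda>K. 2 * (LINT x|cell_measure. (cmod (u (real_point x) - S K x))\<^sup>2) + 2 * (V * (sum_tail c K)\<^sup>2))
      \<longlongrightarrow> 0) (finite_subsets_at_top UNIV)"
    by (auto intro!: tendsto_eq_intros lim sum_tail_tendsto[OF c])
  ultimately have "(LINT x|cell_measure. (cmod (u (real_point x) - U x))\<^sup>2) \<le> 0"
    by (intro tendsto_lowerbound) auto
  then have "(LINT x|cell_measure. (cmod (u (real_point x) - U x))\<^sup>2) = 0"
    by (intro antisym integral_nonneg_AE) auto
  then have "AE x in cell_measure. (cmod (u (real_point x) - U x))\<^sup>2 = 0"
    using integral_nonneg_eq_0_iff_AE[OF uv[OF U_meas Ub]] by simp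
  then show ?thesis
    unfolding c_def[symmetric]
  proof eventually_elim
    case (elim x)
    then show ?case using U[of x] by simp
  qed
qed

text \<open>Since the modes at \<open>l\<close> and \<open>k - l\<close> multiply to the mode at
  \<open>k\<close>, convolving the two families of terms gives the convolved coefficients times the
  mode. It applies at complex points too, given absolute convergence there.\<close>

lemma fourier_series_product:
  assumes a: "(\<lambda>k. cmod (a k * fourier_mode k x)) summable_on UNIV"
    and b: "(\<lambda>k. cmod (b k * fourier_mode k x)) summable_on UNIV"
    and z: "((\<lambda>k. a k * fourier_mode k x) has_sum z) UNIV"
    and w: "((\<lambda>k. b k * fourier_mode k x) has_sum w) UNIV"
  shows "((\<lambda>k. convolution a b k * fourier_mode k x) has_sum z * w) UNIV"
proof -
  have "convolution (\<lambda>k. a k * fourier_mode k x) (\<lambda>k. b k * fourier_mode k x) k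
      = convolution a b k * fourier_mode k x" for k
  proof -
    have "a l * fourier_mode l x * (b (k - l) * fourier_mode (k - l) x) = a l * b (k - l) * fourier_mode k x" for l
      using fourier_mode_add[of l "k - l" x] by simp
    then show ?thesis
      by (simp only: convolution_def infsum_cmult_left')
  qed
  then have "convolution (\<lambda>k. a k * fourier_mode k x) (\<lambda>k. b k * fourier_mode k x)
      = (\<lambda>k. convolution a b k * fourier_mode k x)"
    by (rule ext)
  then show ?thesis
    using has_sum_convolution[OF a b] infsumI[OF z] infsumI[OF w] by simp
qed

section \<open>The algebra property\<close>

lemma real_point_in_strip: "\<rho> \<ge> 0 \<Longrightarrow> real_point x \<in> strip \<rho>"
  by (simp add: strip_def real_point_def)

lemma H_space_coeff_summable:
  fixes u :: "complex ^ 'd \<Rightarrow> complex"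
  assumes r: "real r > real CARD('d) / 2" and "\<rho> \<ge> 0" and u: "u \<in> H_space \<rho> r"
  shows "(\<lambda>k. cmod (fourier_coeff u k)) summable_on UNIV"
  using u by (intro summable_on_norm_of_weighted[OF r \<open>\<rho> \<ge> 0\<close>]) (simp add: H_space_def)

lemma H_space_strip_summable:
  fixes u :: "complex ^ 'd \<Rightarrow> complex"
  assumes r: "real r > real CARD('d) / 2" and u: "u \<in> H_space \<rho> r" and x: "x \<in> strip \<rho>"
  shows "(\<lambda>k. cmod (fourier_coeff u k * fourier_mode k x)) summable_on UNIV"
proof (rule summable_on_comparison_test)
  show "(\<lambda>k. cmod (fourier_coeff u k) * exp (abs1 k * \<rho>)) summable_on UNIV"
    using u by (intro summable_on_exp_weighted[OF r]) (simp add: H_space_def)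
qed (auto simp: norm_mult intro: mult_left_mono norm_fourier_mode_le[OF x])

lemma H_space_has_sum:
  assumes "u \<in> H_space \<rho> r" "\<rho> \<noteq> 0" "x \<in> strip \<rho>"
  shows "((\<lambda>k. fourier_coeff u k * fourier_mode k x) has_sum u x) UNIV"
  using assms by (simp add: H_space_def pointwise_fourier_expansion_def)

text \<open>Gives the cases \<open>\<rho> = 0\<close> and \<open>\<rho> > 0\<close> a common form,
  so that the coefficients of a product are computed once for both.\<close>

lemma H_space_AE_has_sum:
  fixes u :: "complex ^ 'd \<Rightarrow> complex"
  assumes r: "real r > real CARD('d) / 2" and \<rho>: "\<rho> \<ge> 0" and u: "u \<in> H_space \<rho> r"
  shows "AE x in cell_measure. ((\<lambda>k. fourier_coeff u k * fourier_mode k (real_point x)) has_sum u (real_point x)) UNIV"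
proof (cases "\<rho> = 0")
  case True
  then show ?thesis
    using u by (intro L2_fourier_expansion_AE_has_sum H_space_coeff_summable[OF r \<rho>]) (auto simp: H_space_def)
next
  case False
  then show ?thesis
    using H_space_has_sum[OF u False real_point_in_strip[OF \<rho>]] by simp
qed

lemma H_space_measurable:
  fixes u :: "complex ^ 'd \<Rightarrow> complex"
  assumes r: "real r > real CARD('d) / 2" and \<rho>: "\<rho> \<ge> 0" and u: "u \<in> H_space \<rho> r"
  shows "(\<lambda>x. u (real_point x)) \<in> borel_measurable cell_measure"
proof (cases "\<rho> = 0")
  case True
  then show ?thesis
    using u by (simp add: H_space_def L2_fourier_expansion_iff)
next
  case False
  have "(\<lambda>x. u (real_point x)) = (\<lambda>x. \<Sum>\<^sub>\<infinity>k. fourier_coeff u k * fourier_mode k (real_point x))"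
    using infsumI[OF H_space_has_sum[OF u False real_point_in_strip[OF \<rho>]]] by simp
  also have "\<dots> \<in> borel_measurable cell_measure"
    by (intro continuous_imp_measurable_on_sets_lebesgue
        continuous_on_subset[OF continuous_fourier_series[OF H_space_coeff_summable[OF r \<rho> u]]]) auto
  finally show ?thesis .
qed

lemma
  fixes u v :: "complex ^ 'd \<Rightarrow> complex"
  assumes r: "real r > real CARD('d) / 2" and \<rho>: "\<rho> \<ge> 0"
    and u: "u \<in> H_space \<rho> r" and v: "v \<in> H_space \<rho> r"
  shows fourier_coeff_mult:
      "fourier_coeff (\<lambda>x. u x * v x) = convolution (fourier_coeff u) (fourier_coeff v)"
    and H_space_mult: "(\<lambda>x. u x * v x) \<in> H_space \<rho> r"
proof -
  let ?c = "convolution (fourier_coeff u) (fourier_coeff v)"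
  have a: "(\<lambda>k. cmod (fourier_coeff u k)) summable_on UNIV"
    and b: "(\<lambda>k. cmod (fourier_coeff v k)) summable_on UNIV"
    using H_space_coeff_summable[OF r \<rho>] u v by auto
  have c: "(\<lambda>k. cmod (?c k)) summable_on UNIV"
    by (rule abs_summable_convolution[OF a b])
  have meas: "(\<lambda>x. u (real_point x) * v (real_point x)) \<in> borel_measurable cell_measure"
    by (intro borel_measurable_times H_space_measurable[OF r \<rho>] u v)
  have ae: "AE x in cell_measure. ((\<lambda>k. ?c k * fourier_mode k (real_point x))
      has_sum u (real_point x) * v (real_point x)) UNIV"
    using H_space_AE_has_sum[OF r \<rho> u] H_space_AE_has_sum[OF r \<rho> v]
  proof eventually_elim
    case (elim x)
    show ?case
      by (rule fourier_series_product[OF _ _ elim]) (use a b in \<open>simp_all add: norm_mult\<close>)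
  qed
  show coeff: "fourier_coeff (\<lambda>x. u x * v x) = ?c"
    by (rule fourier_coeff_of_series[OF c meas ae])
  have "periodic_on_strip \<rho> (\<lambda>x. u x * v x)"
    using u v by (simp add: H_space_def periodic_on_strip_def)
  moreover have "L2_fourier_expansion (\<lambda>x. u x * v x)"
    by (rule L2_fourier_expansion_of_series[OF c meas ae])
  \<comment> \<open>The coefficients are already known from the real torus; the expansion at complex
    points comes from multiplying the two absolutely convergent series on the closed strip.\<close>
  moreover have "pointwise_fourier_expansion \<rho> (\<lambda>x. u x * v x)" if "\<rho> \<noteq> 0"
    unfolding pointwise_fourier_expansion_def coeff
    by (intro ballI fourier_series_product H_space_strip_summable[OF r u] H_space_strip_summable[OF r v]
        H_space_has_sum[OF u that] H_space_has_sum[OF v that])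
  moreover have "(\<lambda>k. (cmod (?c k))\<^sup>2 * H_weight \<rho> r k) summable_on UNIV"
    using u v by (intro weighted_convolution(1)[OF r \<rho>]) (auto simp: H_space_def)
  ultimately show "(\<lambda>x. u x * v x) \<in> H_space \<rho> r"
    by (simp add: H_space_def coeff)
qed

lemma H_norm_mult_le:
  fixes u v :: "complex ^ 'd \<Rightarrow> complex"
  assumes r: "real r > real CARD('d) / 2" and \<rho>: "\<rho> \<ge> 0"
    and u: "u \<in> H_space \<rho> r" and v: "v \<in> H_space \<rho> r"
  shows "H_norm \<rho> r (\<lambda>x. u x * v x)
    \<le> sqrt (2 * 4 ^ r * (\<Sum>\<^sub>\<infinity>k :: int ^ 'd. 1 / (1 + (abs1 k)\<^sup>2) ^ r)) * H_norm \<rho> r u * H_norm \<rho> r v"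
  unfolding H_norm_def fourier_coeff_mult[OF assms] real_sqrt_mult[symmetric]
  using u v by (intro real_sqrt_le_mono weighted_convolution(2)[OF r \<rho>]) (auto simp: H_space_def)

theorem lemma37:
  fixes r :: nat
  assumes "r > 0" and "real r > real CARD('d::finite) / 2"
  shows "(\<exists>C>0. \<forall>u1 \<in> H_space_real r. \<forall>u2 \<in> H_space_real r.
            (\<lambda>x :: complex ^ 'd. u1 x * u2 x) \<in> H_space_real r \<and>
            H_norm 0 r (\<lambda>x. u1 x * u2 x) \<le> C * H_norm 0 r u1 * H_norm 0 r u2) \<and>
         (\<forall>\<rho>>0. \<exists>C>0. \<forall>u1 \<in> H_space \<rho> r. \<forall>u2 \<in> H_space \<rho> r.
            (\<lambda>x :: complex ^ 'd. u1 x * u2 x) \<in> H_space \<rho> r \<and>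
            H_norm \<rho> r (\<lambda>x. u1 x * u2 x) \<le> C * H_norm \<rho> r u1 * H_norm \<rho> r u2)"
proof -
  note r = assms(2)
  define C where "C = sqrt (2 * 4 ^ r * (\<Sum>\<^sub>\<infinity>k :: int ^ 'd. 1 / (1 + (abs1 k)\<^sup>2) ^ r))"
  \<comment> \<open>The term at \<open>k = 0\<close> equals 1, which makes \<open>C\<close>
    positive. The same \<open>C\<close> serves every \<open>\<rho> \<ge> 0\<close>.\<close>
  have "1 \<le> (\<Sum>\<^sub>\<infinity>k :: int ^ 'd. 1 / (1 + (abs1 k)\<^sup>2) ^ r)"
    using finite_sum_le_infsum[OF summable_on_lattice[OF r], of "{0}"] by simp
  then have "C > 0"
    by (simp add: C_def)
  moreover have "H_norm \<rho> r (\<lambda>x. u1 x * u2 x) \<le> C * H_norm \<rho> r u1 * H_norm \<rho> r u2"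
    if "\<rho> \<ge> 0" "u1 \<in> H_space \<rho> r" "u2 \<in> H_space \<rho> r" for \<rho> and u1 u2 :: "complex ^ 'd \<Rightarrow> complex"
    unfolding C_def by (rule H_norm_mult_le[OF r that])
  ultimately show ?thesis
    by (intro conjI allI impI exI[of _ C] ballI)
      (auto simp: H_space_real_def intro: H_space_mult[OF r])
qed

end
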